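(* Let $q=2^m>4$ and let $l$ be an integer with $0\leq l\leq 3$. Then there exists a linear $l$-intersection pair of two MDS codes over $\mathbb{F}_q$ with parameters $[q+2,3,q]_q$ and $[q+2,q-1,4]_q$.
   Context: An $[n,k,d]_q$ linear code is a $k$-dimensional subspace of $\mathbb{F}_q^n$ with minimum Hamming distance $d$; it is MDS if $d=n-k+1$. Two linear codes $C_1,C_2\subseteq\mathbb{F}_q^n$ form a linear $l$-intersection pair if $\dim(C_1\cap C_2)=l$. *)

theory Defs
  imports "HOL-Analysis.Analysis"
begin

text \<open>Vectors of F_q^n are elements of 'a ^ 'n with CARD('n) = n; scalar
multiplication is (*s), giving the library vector-space interpretation vec.\<close>

definition hamming_dist :: "'a::zero ^ 'n \<Rightarrow> 'a ^ 'n \<Rightarrow> nat" where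
  "hamming_dist x y = card {i. x $ i \<noteq> y $ i}"

definition linear_code :: "('a::field ^ 'n) set \<Rightarrow> bool" where
  "linear_code C \<longleftrightarrow> vec.subspace C"

definition min_dist :: "('a::field ^ 'n) set \<Rightarrow> nat" where
  "min_dist C = Min {hamming_dist x y | x y. x \<in> C \<and> y \<in> C \<and> x \<noteq> y}"

text \<open>An [n,k,d]_q linear code: n = CARD('n), q = CARD('a).\<close>
definition is_code_nkd :: "('a::{field,finite} ^ 'n) set \<Rightarrow> nat \<Rightarrow> nat \<Rightarrow> nat \<Rightarrow> bool" where
  "is_code_nkd C n k d \<longleftrightarrow> linear_code C \<and> CARD('n) = n \<and> vec.dim C = k \<and> min_dist C = d"

definition is_MDS :: "('a::{field,finite} ^ 'n) set \<Rightarrow> bool" where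
  "is_MDS C \<longleftrightarrow> linear_code C \<and> min_dist C = CARD('n) - vec.dim C + 1"

definition l_intersection_pair :: "('a::field ^ 'n) set \<Rightarrow> ('a ^ 'n) set \<Rightarrow> nat \<Rightarrow> bool" where
  "l_intersection_pair C1 C2 l \<longleftrightarrow> linear_code C1 \<and> linear_code C2 \<and> vec.dim (C1 \<inter> C2) = l"

end

theory Submission
  imports Defs "HOL-Computational_Algebra.Polynomial"
begin

text \<open>
  Over a field of characteristic 2 the points \<open>(1,x,x\<^sup>2)\<close>, \<open>(0,1,0)\<close>, \<open>(0,0,1)\<close> of the
  projective plane form a hyperoval: a conic together with its nucleus. No three of them are
  collinear, so evaluating linear forms at them gives a \<open>[q+2,3,q]\<close> code, and its dual, with any
  nonzero column weights, is a \<open>[q+2,q-1,4]\<close> code. Take for \<open>C1\<close> the hyperoval code and for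
  \<open>C2\<close> the weighted dual of the hyperoval code precomposed with \<open>x \<mapsto> 1/x\<close>, with weights \<open>s, u, w\<close> at
  \<open>(1,0,0)\<close>, \<open>(0,1,0)\<close>, \<open>(0,0,1)\<close> and weight 1 elsewhere. Since \<open>x\<close>, \<open>x\<^sup>2\<close>, \<open>1/x\<close>, \<open>1/x\<^sup>2\<close> sum to 0
  over the nonzero elements, the Gram matrix of the two generator matrices is
  \<open>diag(1+s, 1+u, 1+w)\<close>, and the intersection has dimension equal to the number of weights
  among \<open>s, u, w\<close> that are 1.
\<close>

section \<open>Linear codes\<close>

text \<open>The distance of \<open>x\<close> and \<open>y\<close> is the weight of
  \<open>x - y\<close>, which lies in the code again, so the minimum distance is the smallest
  nonzero weight.\<close>

lemma min_dist_eqI: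
  fixes C :: "('a::field ^ 'n) set"
  assumes "linear_code C"
    and lower: "\<And>x. x \<in> C \<Longrightarrow> x \<noteq> 0 \<Longrightarrow> d \<le> card {i. x $ i \<noteq> 0}"
    and x: "x \<in> C" "x \<noteq> 0" "card {i. x $ i \<noteq> 0} = d"
  shows "min_dist C = d"
  unfolding min_dist_def
proof (rule Min_eqI)
  have sub: "vec.subspace C" using assms(1) by (simp add: linear_code_def)
  show "finite {hamming_dist x y | x y. x \<in> C \<and> y \<in> C \<and> x \<noteq> y}"
    by (rule finite_subset[of _ "{..CARD('n)}"]) (auto simp: hamming_dist_def intro: card_mono)
  show "d \<le> k" if "k \<in> {hamming_dist x y | x y. x \<in> C \<and> y \<in> C \<and> x \<noteq> y}" for k
  proof -
    from that obtain x y where xy: "k = hamming_dist x y" "x \<in> C" "y \<in> C" "x \<noteq> y" by blast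
    show ?thesis
      using lower[of "x - y"] xy vec.subspace_diff[OF sub] by (simp add: hamming_dist_def)
  qed
  have "hamming_dist x 0 = d" using x by (simp add: hamming_dist_def)
  then show "d \<in> {hamming_dist x y | x y. x \<in> C \<and> y \<in> C \<and> x \<noteq> y}"
    using x vec.subspace_0[OF sub] by blast
qed

text \<open>\<open>I\<close> is an information set: keeping the entries in \<open>I\<close> and
  zeroing the others maps \<open>V\<close> injectively onto a coordinate subspace. This turns each
  dimension below into a count of coordinates, without choosing bases.\<close>

lemma dim_information_set:
  fixes V :: "('a::field ^ 'n) set"
  assumes V: "vec.subspace V"
    and inj: "\<And>x. x \<in> V \<Longrightarrow> (\<And>i. i \<in> I \<Longrightarrow> x $ i = 0) \<Longrightarrow> x = 0"
    and surj: "\<And>y :: 'a ^ 'n. \<exists>x \<in> V. \<forall>i \<in> I. x $ i = y $ i"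
  shows "vec.dim V = card I"
proof -
  define f :: "'a ^ 'n \<Rightarrow> 'a ^ 'n" where "f x = (\<chi> i. if i \<in> I then x $ i else 0)" for x
  have lin: "Vector_Spaces.linear (*s) (*s) f"
    by unfold_locales (auto simp: f_def vec_eq_iff)
  have "inj_on f V"
  proof (rule inj_onI)
    fix x y assume xy: "x \<in> V" "y \<in> V" "f x = f y"
    then have "x $ i = y $ i" if "i \<in> I" for i
      using that by (auto simp: f_def vec_eq_iff dest: spec[of _ i])
    then have "x - y = 0" using xy vec.subspace_diff[OF V] by (intro inj) auto
    then show "x = y" by simp
  qed
  then have "vec.dim (f ` V) = vec.dim V"
    using V by (intro vec.dim_image_eq[OF lin]) (simp add: vec.span_eq_iff[THEN iffD2])
  moreover have "f ` V = {x. \<forall>i. i \<notin> I \<longrightarrow> x $ i = 0}"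
  proof (intro subset_antisym subsetI)
    fix y :: "'a ^ 'n" assume y: "y \<in> {x. \<forall>i. i \<notin> I \<longrightarrow> x $ i = 0}"
    obtain x where "x \<in> V" "\<forall>i \<in> I. x $ i = y $ i" using surj by blast
    moreover from this y have "f x = y" by (auto simp: f_def vec_eq_iff)
    ultimately show "y \<in> f ` V" by blast
  qed (auto simp: f_def)
  ultimately show ?thesis by (simp add: dim_substandard_cart)
qed

text \<open>The orthogonal complement for the diagonal bilinear form with entries
  \<open>w i\<close>. For nonzero weights it is the usual dual with column \<open>i\<close> divided
  by \<open>w i\<close>.\<close>

definition weighted_dual :: "('n \<Rightarrow> 'a) \<Rightarrow> ('a::field ^ 'n) set \<Rightarrow> ('a ^ 'n) set" where
  "weighted_dual w C = {x. \<forall>y \<in> C. (\<Sum>i\<in>UNIV. w i * y $ i * x $ i) = 0}"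

lemma subspace_weighted_dual: "vec.subspace (weighted_dual w C)"
  unfolding vec.subspace_def
proof (intro conjI ballI allI)
  fix x y assume "x \<in> weighted_dual w C" "y \<in> weighted_dual w C"
  then show "x + y \<in> weighted_dual w C"
    by (simp add: weighted_dual_def distrib_left sum.distrib)
next
  fix c x assume x: "x \<in> weighted_dual w C"
  have "(\<Sum>i\<in>UNIV. w i * y $ i * (c *s x) $ i) = c * (\<Sum>i\<in>UNIV. w i * y $ i * x $ i)" for y
    by (simp add: sum_distrib_left ac_simps)
  then show "c *s x \<in> weighted_dual w C"
    using x by (simp add: weighted_dual_def)
qed (simp add: weighted_dual_def)

section \<open>Finite fields of characteristic 2\<close>

lemma field_elem_not_0_1:
  assumes "CARD('a::{field,finite}) > 2"
  obtains g :: "'a::{field,finite}" where "g \<noteq> 0" "g \<noteq> 1"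
proof -
  have "\<not> UNIV \<subseteq> {0, 1 :: 'a}"
  proof
    assume "UNIV \<subseteq> {0, 1 :: 'a}"
    then have "CARD('a) \<le> card {0, 1 :: 'a}" by (intro card_mono) auto
    then show False using assms by simp
  qed
  then show ?thesis using that by auto
qed

text \<open>Translation by 1 permutes the field, so the sum of all elements does not change when 1
  is added to each term.\<close>

lemma of_nat_card_field: "of_nat CARD('a::{field,finite}) = (0 :: 'a)"
proof -
  have "(\<Sum>x\<in>UNIV. x :: 'a) = (\<Sum>x\<in>UNIV. x + 1)"
    by (rule sum.reindex_bij_witness[of _ "\<lambda>x. x + 1" "\<lambda>x. x - 1"]) auto
  then show ?thesis by (simp add: sum.distrib)
qed

lemma char_two_of_card:
  assumes "CARD('a::{field,finite}) = 2 ^ m"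
  shows "(1 :: 'a) + 1 = 0"
proof -
  have "(2 :: 'a) ^ m = 0" using of_nat_card_field[where 'a = 'a] assms by simp
  then show ?thesis by simp
qed

lemma char_two_minus:
  fixes x :: "'a::ring_1"
  assumes "(1 :: 'a) + 1 = 0"
  shows "- x = x"
proof -
  have "x + x = (1 + 1) * x" by (simp only: distrib_right mult_1)
  then have "x + x = 0" using assms by simp
  then show ?thesis by (simp add: add_eq_0_iff)
qed

lemma char_two_square_inj:
  fixes x y :: "'a::field"
  assumes "(1 :: 'a) + 1 = 0" "x\<^sup>2 = y\<^sup>2"
  shows "x = y"
  using assms(2) char_two_minus[OF assms(1)] by (auto simp: power2_eq_iff)

text \<open>Multiplication by \<open>g\<close> permutes the nonzero elements and multiplies the sum
  by \<open>c\<close>; a sum fixed by a factor other than 1 vanishes.\<close>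

lemma sum_nonzero_eq_0:
  fixes f :: "'a::{field,finite} \<Rightarrow> 'a"
  assumes "g \<noteq> 0" "c \<noteq> 1" and f: "\<And>x. f (g * x) = c * f x"
  shows "(\<Sum>x\<in>-{0}. f x) = 0"
proof -
  have "(\<Sum>x\<in>-{0}. f x) = (\<Sum>x\<in>-{0}. f (g * x))"
    by (rule sum.reindex_bij_witness[of _ "\<lambda>x. g * x" "\<lambda>x. x / g"]) (use \<open>g \<noteq> 0\<close> in auto)
  also have "\<dots> = c * (\<Sum>x\<in>-{0}. f x)" by (simp add: f sum_distrib_left)
  finally have "(1 - c) * (\<Sum>x\<in>-{0}. f x) = 0" by (simp add: algebra_simps)
  then show ?thesis using \<open>c \<noteq> 1\<close> by simp
qed

section \<open>The hyperoval\<close>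

text \<open>The constructor \<open>Some (Some x)\<close> stands for the point \<open>(1,x,x\<^sup>2)\<close> of the conic, \<open>None\<close> for its
  point \<open>(0,0,1)\<close> at infinity, and \<open>Some None\<close> for the nucleus \<open>(0,1,0)\<close>.\<close>

definition hyperoval_eval :: "'a::field \<Rightarrow> 'a \<Rightarrow> 'a \<Rightarrow> 'a option option \<Rightarrow> 'a" where
  "hyperoval_eval a b c p = (case p of None \<Rightarrow> c | Some None \<Rightarrow> b
     | Some (Some x) \<Rightarrow> a + b * x + c * x\<^sup>2)"

lemma hyperoval_eval_simps [simp]:
  "hyperoval_eval a b c None = c"
  "hyperoval_eval a b c (Some None) = b"
  "hyperoval_eval a b c (Some (Some x)) = a + b * x + c * x\<^sup>2"
  by (simp_all add: hyperoval_eval_def)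

lemma hyperoval_cases:
  obtains "p = None" | "p = Some None" | x where "p = Some (Some x)"
  by (metis option.exhaust)

lemma hyperoval_eval_expand:
  "hyperoval_eval a b c p =
     a * hyperoval_eval 1 0 0 p + b * hyperoval_eval 0 1 0 p + c * hyperoval_eval 0 0 1 p"
  by (auto simp: hyperoval_eval_def split: option.split)

lemma hyperoval_eval_add:
  "hyperoval_eval (a + a') (b + b') (c + c') p = hyperoval_eval a b c p + hyperoval_eval a' b' c' p"
  by (auto simp: hyperoval_eval_def algebra_simps split: option.split)

lemma hyperoval_eval_scale:
  "hyperoval_eval (k * a) (k * b) (k * c) p = k * hyperoval_eval a b c p"
  by (auto simp: hyperoval_eval_def algebra_simps split: option.split)

lemma sum_option_option:
  fixes f :: "'a::finite option option \<Rightarrow> 'b::comm_monoid_add"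
  shows "(\<Sum>p\<in>UNIV. f p) = f None + f (Some None) + (\<Sum>x\<in>UNIV. f (Some (Some x)))"
  by (simp add: UNIV_option_conv sum.reindex sum.insert image_iff ac_simps)

text \<open>The zeros are the points of the hyperoval on a line. If the line misses the nucleus,
  they are the at most two zeros of a binary quadratic form; if it contains the nucleus, injectivity
  of squaring leaves at most one further point.\<close>

lemma card_hyperoval_zeros:
  fixes a b c :: "'a::{field,finite}"
  assumes char2: "(1 :: 'a) + 1 = 0" and nz: "a \<noteq> 0 \<or> b \<noteq> 0 \<or> c \<noteq> 0"
  shows "card {p. hyperoval_eval a b c p = 0} \<le> 2"
proof -
  define R where "R = {x. a + b * x + c * x\<^sup>2 = 0}"
  define S :: "'a option option set" where "S = (if b = 0 then {Some None} else {}) \<union> (if c = 0 then {None} else {})"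
  have "{p. hyperoval_eval a b c p = 0} \<subseteq> (\<lambda>x. Some (Some x)) ` R \<union> S"
  proof
    fix p assume "p \<in> {p. hyperoval_eval a b c p = 0}"
    then show "p \<in> (\<lambda>x. Some (Some x)) ` R \<union> S"
      by (cases p rule: hyperoval_cases) (auto simp: R_def S_def)
  qed
  then have "card {p. hyperoval_eval a b c p = 0} \<le> card ((\<lambda>x. Some (Some x)) ` R \<union> S)"
    by (intro card_mono) (auto simp: S_def)
  also have "\<dots> \<le> card ((\<lambda>x. Some (Some x)) ` R) + card S" by (rule card_Un_le)
  also have "\<dots> \<le> card R + card S" by (simp add: card_image_le)
  also have "\<dots> \<le> 2"
  proof (cases "b = 0")
    case False
    have "R = {x. poly [:a, b, c:] x = 0}"
      by (simp add: R_def algebra_simps power2_eq_square)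
    then have "card R \<le> degree [:a, b, c:]"
      using False card_poly_roots_bound[of "[:a, b, c:]"] by simp
    \<comment> \<open>The point at infinity counts only when \<open>c = 0\<close>, and then the
      degree drops to 1.\<close>
    then show ?thesis using False by (auto simp: S_def split: if_splits)
  next
    case b: True
    show ?thesis
    proof (cases "c = 0")
      case True
      then show ?thesis using b nz by (simp add: R_def S_def)
    next
      case False
      have "x = y" if "x \<in> R" "y \<in> R" for x y
      proof (rule char_two_square_inj[OF char2])
        have "a + c * x\<^sup>2 = a + c * y\<^sup>2" using that b by (simp add: R_def)
        then show "x\<^sup>2 = y\<^sup>2" using False by simp
      qed
      then have "card R \<le> 1" by (simp add: card_le_Suc0_iff_eq)
      then show ?thesis using b False by (simp add: S_def)
    qed
  qed
  finally show ?thesis .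
qed

lemma line_through_two_points:
  fixes p q :: "'a::field option option"
  obtains a b c where "a \<noteq> 0 \<or> b \<noteq> 0 \<or> c \<noteq> 0"
    "hyperoval_eval a b c p = 0" "hyperoval_eval a b c q = 0"
proof -
  have "\<exists>a b c. (a \<noteq> 0 \<or> b \<noteq> 0 \<or> c \<noteq> 0) \<and>
      hyperoval_eval a b c p = 0 \<and> hyperoval_eval a b c q = 0"
  proof -
    \<comment> \<open>The coefficients are those of (z - x)(z - y); the next cases use z^2 - x^2, z
      - x and the constant 1.\<close>
    have conic: ?thesis if "p = Some (Some x)" "q = Some (Some y)" for x y
      by (rule exI[of _ "x * y"], rule exI[of _ "- x - y"], rule exI[of _ 1])
        (simp add: that algebra_simps power2_eq_square)
    have nucleus: ?thesis
      if "p = Some (Some x) \<and> q = Some None \<or> q = Some (Some x) \<and> p = Some None" for x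
      by (rule exI[of _ "- x\<^sup>2"], rule exI[of _ 0], rule exI[of _ 1]) (use that in auto)
    have infinity: ?thesis
      if "p = Some (Some x) \<and> q = None \<or> q = Some (Some x) \<and> p = None" for x
      by (rule exI[of _ "- x"], rule exI[of _ 1], rule exI[of _ 0]) (use that in auto)
    have both: ?thesis if "p \<in> {None, Some None}" "q \<in> {None, Some None}"
      by (rule exI[of _ 1], rule exI[of _ 0], rule exI[of _ 0]) (use that in auto)
    show ?thesis
      by (cases p rule: hyperoval_cases; cases q rule: hyperoval_cases)
        (rule conic, assumption, assumption | rule nucleus, fast | rule infinity, fast
          | rule both, simp, simp)+
  qed
  then show ?thesis using that by blast
qed

text \<open>After \<open>T\<close> is enlarged to exactly two points other than \<open>r\<close>,
  the line through them has no room for a third point, so it misses \<open>r\<close>.\<close>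

lemma hyperoval_separate:
  fixes T :: "'a::{field,finite} option option set"
  assumes char2: "(1 :: 'a) + 1 = 0" and T: "card T \<le> 2" "r \<notin> T"
  obtains a b c where "\<And>p. p \<in> T \<Longrightarrow> hyperoval_eval a b c p = 0" "hyperoval_eval a b c r \<noteq> 0"
proof -
  have "card (UNIV :: 'a set) \<ge> card {0, 1 :: 'a}" by (intro card_mono) auto
  then have "2 \<le> card (UNIV - {r})" by (simp add: card_UNIV_option card_Diff_singleton)
  then obtain T' where T': "T \<subseteq> T'" "T' \<subseteq> UNIV - {r}" "card T' = 2"
    using exists_subset_between[of T 2 "UNIV - {r}"] T by auto
  then obtain p q where pq: "T' = {p, q}" "p \<noteq> q" by (auto simp: card_2_iff)
  obtain a b c where abc: "a \<noteq> 0 \<or> b \<noteq> 0 \<or> c \<noteq> 0"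
    "hyperoval_eval a b c p = 0" "hyperoval_eval a b c q = 0"
    using line_through_two_points[of p q] by blast
  have "T' = {p. hyperoval_eval a b c p = 0}"
    by (rule card_seteq) (use abc pq T' card_hyperoval_zeros[OF char2 abc(1)] in auto)
  then show ?thesis using that[of a b c] T' by blast
qed

section \<open>The hyperoval code and its weighted dual\<close>

text \<open>The map \<open>h\<close> labels coordinates by points. It is a parameter so that the
  same results apply to \<open>h\<close> and to \<open>hyperoval_inv \<circ> h\<close>.\<close>

definition hyperoval_code :: "('n \<Rightarrow> 'a::field option option) \<Rightarrow> ('a ^ 'n) set" where
  "hyperoval_code h = {(\<chi> i. hyperoval_eval a b c (h i)) | a b c. True}"

lemma subspace_hyperoval_code: "vec.subspace (hyperoval_code h)"
  unfolding vec.subspace_def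
proof (intro conjI ballI allI)
  have "0 = (\<chi> i. hyperoval_eval 0 0 0 (h i))"
    by (simp add: vec_eq_iff hyperoval_eval_def split: option.split)
  then show "0 \<in> hyperoval_code h" unfolding hyperoval_code_def by blast
next
  fix x y assume "x \<in> hyperoval_code h" "y \<in> hyperoval_code h"
  then obtain a b c a' b' c' where "x = (\<chi> i. hyperoval_eval a b c (h i))"
    "y = (\<chi> i. hyperoval_eval a' b' c' (h i))"
    by (auto simp: hyperoval_code_def)
  then have "x + y = (\<chi> i. hyperoval_eval (a + a') (b + b') (c + c') (h i))"
    by (simp add: vec_eq_iff hyperoval_eval_add)
  then show "x + y \<in> hyperoval_code h" unfolding hyperoval_code_def by blast
next
  fix k x assume "x \<in> hyperoval_code h"
  then obtain a b c where "x = (\<chi> i. hyperoval_eval a b c (h i))"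
    by (auto simp: hyperoval_code_def)
  then have "k *s x = (\<chi> i. hyperoval_eval (k * a) (k * b) (k * c) (h i))"
    by (simp add: vec_eq_iff hyperoval_eval_scale)
  then show "k *s x \<in> hyperoval_code h" unfolding hyperoval_code_def by blast
qed

section \<open>Parameters of the hyperoval code\<close>

lemma card_Compl_finite:
  fixes A :: "'a::finite set"
  shows "card (- A) = CARD('a) - card A"
  by (simp add: Compl_eq_Diff_UNIV card_Diff_subset)

lemma card_bij_Collect:
  assumes "bij h"
  shows "card {i. P (h i)} = card {p. P p}"
proof -
  have "{p. P p} = h ` {i. P (h i)}"
    using bij_is_surj[OF assms] by (auto simp: image_iff dest: surjD)
  then show ?thesis
    using bij_is_inj[OF assms] by (simp add: card_image inj_on_subset)
qed

text \<open>At the coordinates labelled (1,0,0), (0,1,0), (0,0,1) a codeword shows its coefficients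
  \<open>a\<close>, \<open>b\<close>, \<open>c\<close>, so these form an information set.\<close>

lemma hyperoval_frame:
  fixes h :: "'n \<Rightarrow> 'a::field option option"
  assumes "bij h"
  obtains i0 i1 i2 where "h i0 = Some (Some 0)" "h i1 = Some None" "h i2 = None"
    "i0 \<noteq> i1" "i0 \<noteq> i2" "i1 \<noteq> i2"
  using assms by (metis bij_pointE option.distinct(1) option.inject)

lemma dim_hyperoval_code:
  fixes h :: "'n::finite \<Rightarrow> 'a::field option option"
  assumes "bij h"
  shows "vec.dim (hyperoval_code h) = 3"
proof -
  obtain i0 i1 i2 where i: "h i0 = Some (Some 0)" "h i1 = Some None" "h i2 = None"
    "i0 \<noteq> i1" "i0 \<noteq> i2" "i1 \<noteq> i2"
    using hyperoval_frame[OF assms] .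
  have "vec.dim (hyperoval_code h) = card {i0, i1, i2}"
  proof (rule dim_information_set[OF subspace_hyperoval_code])
    fix x assume "x \<in> hyperoval_code h" and z: "\<And>i. i \<in> {i0, i1, i2} \<Longrightarrow> x $ i = 0"
    then obtain a b c where x: "x = (\<chi> i. hyperoval_eval a b c (h i))"
      by (auto simp: hyperoval_code_def)
    show "x = 0"
      using z[of i0] z[of i1] z[of i2] i
      by (auto simp: x vec_eq_iff hyperoval_eval_def split: option.split)
  next
    fix y :: "'a ^ 'n"
    let ?x = "\<chi> i. hyperoval_eval (y $ i0) (y $ i1) (y $ i2) (h i)"
    have "?x \<in> hyperoval_code h" by (auto simp: hyperoval_code_def)
    moreover have "\<forall>i\<in>{i0, i1, i2}. ?x $ i = y $ i" using i by simp
    ultimately show "\<exists>x \<in> hyperoval_code h. \<forall>i\<in>{i0, i1, i2}. x $ i = y $ i" by blast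
  qed
  then show ?thesis using i by simp
qed

lemma min_dist_hyperoval_code:
  fixes h :: "'n::finite \<Rightarrow> 'a::{field,finite} option option"
  assumes h: "bij h" and char2: "(1 :: 'a) + 1 = 0"
  shows "min_dist (hyperoval_code h) = CARD('a)"
proof (rule min_dist_eqI)
  show "linear_code (hyperoval_code h)"
    by (simp add: linear_code_def subspace_hyperoval_code)
  have weight: "card {i. hyperoval_eval a b c (h i) \<noteq> 0} + card {p. hyperoval_eval a b c p = 0}
      = CARD('a) + 2" for a b c
  proof -
    have "card {i. hyperoval_eval a b c (h i) \<noteq> 0} = card (- {p. hyperoval_eval a b c p = 0})"
      using card_bij_Collect[OF h, of "\<lambda>p. hyperoval_eval a b c p \<noteq> 0"]
      by (simp add: Collect_neg_eq)
    then show ?thesis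
      using card_mono[of UNIV "{p. hyperoval_eval a b c p = 0}"]
      by (simp add: card_Compl_finite card_UNIV_option)
  qed
  fix x assume "x \<in> hyperoval_code h" "x \<noteq> 0"
  then obtain a b c where x: "x = (\<chi> i. hyperoval_eval a b c (h i))"
    by (auto simp: hyperoval_code_def)
  have "a \<noteq> 0 \<or> b \<noteq> 0 \<or> c \<noteq> 0"
    using \<open>x \<noteq> 0\<close> by (auto simp: x vec_eq_iff hyperoval_eval_def split: option.splits)
  then have "card {p. hyperoval_eval a b c p = 0} \<le> 2" by (rule card_hyperoval_zeros[OF char2])
  then show "CARD('a) \<le> card {i. x $ i \<noteq> 0}" using weight[of a b c] by (simp add: x)
next
  \<comment> \<open>This form vanishes at exactly two points, (1,0,0) and (0,0,1), so the weight
    bound is attained.\<close>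
  let ?x = "\<chi> i. hyperoval_eval 0 1 0 (h i)"
  show "?x \<in> hyperoval_code h" by (auto simp: hyperoval_code_def)
  have "hyperoval_eval 0 1 0 p = (0::'a) \<longleftrightarrow> p = None \<or> p = Some (Some 0)" for p
    by (cases p rule: hyperoval_cases) auto
  then have "{p. hyperoval_eval 0 1 0 p = (0::'a)} = {None, Some (Some 0)}" by auto
  moreover have "card {i. hyperoval_eval 0 1 0 (h i) \<noteq> (0::'a)} = card (- {p. hyperoval_eval 0 1 0 p = (0::'a)})"
    using card_bij_Collect[OF h, of "\<lambda>p. hyperoval_eval 0 1 0 p \<noteq> 0"]
    by (simp add: Collect_neg_eq)
  ultimately show *: "card {i. ?x $ i \<noteq> 0} = CARD('a)"
    by (simp add: card_Compl_finite card_UNIV_option)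
  show "?x \<noteq> 0"
  proof
    assume "?x = 0"
    then have "{i. ?x $ i \<noteq> 0} = {}" by (simp only:) simp
    then have "CARD('a) = 0" using * by (simp only: card.empty)
    then show False by simp
  qed
qed

section \<open>Parity checks and parameters of the weighted dual\<close>

lemma mem_weighted_dual_hyperoval:
  fixes h :: "'n::finite \<Rightarrow> 'a::field option option"
  shows "x \<in> weighted_dual w (hyperoval_code h) \<longleftrightarrow>
    (\<forall>a b c. (\<Sum>i\<in>UNIV. w i * hyperoval_eval a b c (h i) * x $ i) = 0)"
proof
  assume x: "x \<in> weighted_dual w (hyperoval_code h)"
  show "\<forall>a b c. (\<Sum>i\<in>UNIV. w i * hyperoval_eval a b c (h i) * x $ i) = 0"
  proof (intro allI)
    fix a b c
    have "(\<chi> i. hyperoval_eval a b c (h i)) \<in> hyperoval_code h"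
      by (auto simp: hyperoval_code_def)
    then show "(\<Sum>i\<in>UNIV. w i * hyperoval_eval a b c (h i) * x $ i) = 0"
      using x by (force simp: weighted_dual_def)
  qed
qed (auto simp: weighted_dual_def hyperoval_code_def)

lemma mem_weighted_dual_hyperoval':
  fixes h :: "'n::finite \<Rightarrow> 'a::field option option"
  shows "x \<in> weighted_dual w (hyperoval_code h) \<longleftrightarrow>
    (\<Sum>i\<in>UNIV. w i * hyperoval_eval 1 0 0 (h i) * x $ i) = 0 \<and>
    (\<Sum>i\<in>UNIV. w i * hyperoval_eval 0 1 0 (h i) * x $ i) = 0 \<and>
    (\<Sum>i\<in>UNIV. w i * hyperoval_eval 0 0 1 (h i) * x $ i) = 0"
proof -
  have "(\<Sum>i\<in>UNIV. w i * hyperoval_eval a b c (h i) * x $ i) =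
      a * (\<Sum>i\<in>UNIV. w i * hyperoval_eval 1 0 0 (h i) * x $ i) +
      b * (\<Sum>i\<in>UNIV. w i * hyperoval_eval 0 1 0 (h i) * x $ i) +
      c * (\<Sum>i\<in>UNIV. w i * hyperoval_eval 0 0 1 (h i) * x $ i)" for a b c
    by (subst hyperoval_eval_expand)
      (simp only: sum_distrib_left flip: sum.distrib, rule sum.cong, simp_all add: algebra_simps)
  then show ?thesis unfolding mem_weighted_dual_hyperoval by fastforce
qed

text \<open>The complement of the frame is an information set: each of the three parity checks
  involves just one frame coordinate, with nonzero weight, and determines its entry from those
  outside the frame.\<close>

lemma dim_weighted_dual_hyperoval:
  fixes h :: "'n::finite \<Rightarrow> 'a::field option option"
  assumes h: "bij h" and w: "\<And>i. w i \<noteq> 0"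
  shows "vec.dim (weighted_dual w (hyperoval_code h)) = CARD('n) - 3"
proof -
  obtain i0 i1 i2 where i: "h i0 = Some (Some 0)" "h i1 = Some None" "h i2 = None"
    "i0 \<noteq> i1" "i0 \<noteq> i2" "i1 \<noteq> i2"
    using hyperoval_frame[OF h] .
  define J where "J = - {i0, i1, i2}"
  have split: "(\<Sum>i\<in>UNIV. f i) = f i0 + f i1 + f i2 + (\<Sum>i\<in>J. f i)" for f :: "'n \<Rightarrow> 'a"
  proof -
    have "(\<Sum>i\<in>UNIV. f i) = (\<Sum>i\<in>{i0, i1, i2}. f i) + (\<Sum>i\<in>J. f i)"
      unfolding J_def by (subst sum.union_disjoint[symmetric]) (auto intro: sum.cong)
    then show ?thesis using i by (simp add: ac_simps)
  qed
  have "vec.dim (weighted_dual w (hyperoval_code h)) = card J"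
  proof (rule dim_information_set[OF subspace_weighted_dual])
    fix x assume x: "x \<in> weighted_dual w (hyperoval_code h)" and z: "\<And>i. i \<in> J \<Longrightarrow> x $ i = 0"
    have "x $ i0 = 0" "x $ i1 = 0" "x $ i2 = 0"
      using x i w by (simp_all add: mem_weighted_dual_hyperoval' split z)
    then have "x $ i = 0" for i using z[of i] by (cases "i \<in> J") (auto simp: J_def)
    then show "x = 0" by (simp add: vec_eq_iff)
  next
    fix y :: "'a ^ 'n"
    \<comment> \<open>The frame entry times its weight must cancel the contribution of
      \<open>J\<close> to its parity check.\<close>
    define s where "s a b c = - (\<Sum>i\<in>J. w i * hyperoval_eval a b c (h i) * y $ i)" for a b c
    define x where "x = (\<chi> i. if i = i0 then s 1 0 0 / w i0 else if i = i1 then s 0 1 0 / w i1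
      else if i = i2 then s 0 0 1 / w i2 else y $ i)"
    have eq: "x $ i = y $ i" if "i \<in> J" for i using that by (auto simp: x_def J_def)
    have x012: "x $ i0 = s 1 0 0 / w i0" "x $ i1 = s 0 1 0 / w i1" "x $ i2 = s 0 0 1 / w i2"
      using i by (auto simp: x_def)
    have "x \<in> weighted_dual w (hyperoval_code h)"
      using i w by (simp add: mem_weighted_dual_hyperoval' split eq x012) (simp add: s_def)
    then show "\<exists>x \<in> weighted_dual w (hyperoval_code h). \<forall>i\<in>J. x $ i = y $ i" using eq by blast
  qed
  then show ?thesis using i by (simp add: J_def card_Compl_finite)
qed

text \<open>For a nonzero word of weight at most 3, a form vanishing at all but one point of the
  support gives a parity check with a single nonzero term. Weight 4 comes from four dependent
  points.\<close>

lemma min_dist_weighted_dual_hyperoval: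
  fixes h :: "'n::finite \<Rightarrow> 'a::{field,finite} option option"
  assumes h: "bij h" and char2: "(1 :: 'a) + 1 = 0" and w: "\<And>i. w i \<noteq> 0"
  shows "min_dist (weighted_dual w (hyperoval_code h)) = 4"
proof (rule min_dist_eqI)
  show "linear_code (weighted_dual w (hyperoval_code h))"
    by (simp add: linear_code_def subspace_weighted_dual)
  fix x assume x: "x \<in> weighted_dual w (hyperoval_code h)" and "x \<noteq> 0"
  show "4 \<le> card {i. x $ i \<noteq> 0}"
  proof (rule ccontr)
    assume less: "\<not> 4 \<le> card {i. x $ i \<noteq> 0}"
    obtain j where j: "x $ j \<noteq> 0" using \<open>x \<noteq> 0\<close> by (auto simp: vec_eq_iff)
    define T where "T = h ` ({i. x $ i \<noteq> 0} - {j})"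
    have "card T \<le> card ({i. x $ i \<noteq> 0} - {j})" unfolding T_def by (rule card_image_le) simp
    also have "\<dots> \<le> 2" using less j by (simp add: card_Diff_singleton)
    finally have "card T \<le> 2" .
    moreover have "h j \<notin> T" using bij_is_inj[OF h] by (auto simp: T_def dest: injD)
    ultimately obtain a b c where abc: "\<And>p. p \<in> T \<Longrightarrow> hyperoval_eval a b c p = 0"
      "hyperoval_eval a b c (h j) \<noteq> 0"
      using hyperoval_separate[OF char2] by blast
    have "(\<Sum>i\<in>UNIV. w i * hyperoval_eval a b c (h i) * x $ i) =
        (\<Sum>i\<in>{j}. w i * hyperoval_eval a b c (h i) * x $ i)"
      by (rule sum.mono_neutral_right) (auto simp: abc(1) T_def)
    then have "w j * hyperoval_eval a b c (h j) * x $ j = 0"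
      using x by (simp add: mem_weighted_dual_hyperoval)
    then show False using abc(2) w j by simp
  qed
next
  text \<open>\<open>(1,0,0) + (1,1,1) + (0,1,0) + (0,0,1) = 0\<close> in characteristic 2.\<close>
  define S :: "'a option option set" where
    "S = {None, Some None, Some (Some 0), Some (Some 1)}"
  define x where "x = (\<chi> i. if h i \<in> S then 1 / w i else 0)"
  have "{i. x $ i \<noteq> 0} = {i. h i \<in> S}" using w by (auto simp: x_def)
  then have "card {i. x $ i \<noteq> 0} = card S"
    using card_bij_Collect[OF h, of "\<lambda>p. p \<in> S"] by simp
  then show card: "card {i. x $ i \<noteq> 0} = 4" by (simp add: S_def)
  show "x \<noteq> 0" using card by auto
  have "(\<Sum>i\<in>UNIV. w i * hyperoval_eval a b c (h i) * x $ i) = 0" for a b c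
  proof -
    have "(\<Sum>i\<in>UNIV. w i * hyperoval_eval a b c (h i) * x $ i) =
        (\<Sum>i\<in>UNIV. if h i \<in> S then hyperoval_eval a b c (h i) else 0)"
      using w by (intro sum.cong) (auto simp: x_def)
    also have "\<dots> = (\<Sum>p\<in>UNIV. if p \<in> S then hyperoval_eval a b c p else 0)"
      by (rule sum.reindex_bij_betw[OF h])
    also have "\<dots> = (\<Sum>p\<in>S. hyperoval_eval a b c p)"
      by (rule sum.mono_neutral_cong_right) auto
    also have "\<dots> = (1 + 1) * (a + b + c)" by (simp add: S_def algebra_simps)
    finally show ?thesis using char2 by simp
  qed
  then show "x \<in> weighted_dual w (hyperoval_code h)" by (simp add: mem_weighted_dual_hyperoval)
qed

section \<open>The intersection\<close>

text \<open>By \<open>inverse 0 = 0\<close> the inversion fixes the point \<open>(1,0,0)\<close>, besides \<open>(0,1,0)\<close> and \<open>(0,0,1)\<close>.\<close>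

definition hyperoval_inv :: "'a::field option option \<Rightarrow> 'a option option" where
  "hyperoval_inv = map_option (map_option inverse)"

text \<open>The adjustable weights sit at the points fixed by the inversion where two of the three
  basis forms vanish, so each of them affects one diagonal entry of the Gram matrix only.\<close>

definition frame_weight :: "'a::field \<Rightarrow> 'a \<Rightarrow> 'a \<Rightarrow> 'a option option \<Rightarrow> 'a" where
  "frame_weight s u w p = (case p of None \<Rightarrow> w | Some None \<Rightarrow> u
     | Some (Some x) \<Rightarrow> if x = 0 then s else 1)"

lemma bij_hyperoval_inv: "bij (hyperoval_inv :: 'a::field option option \<Rightarrow> _)"
proof -
  have "hyperoval_inv \<circ> hyperoval_inv = (id :: 'a option option \<Rightarrow> _)"
    by (auto simp: hyperoval_inv_def option.map_comp o_def fun_eq_iff option.map_ident)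
  then show ?thesis using o_bij by blast
qed

text \<open>Over nonzero \<open>x\<close> the product expands into powers of \<open>x\<close> from
  -2 to 2. Only the constant term survives summation, and the three frame points add the terms with
  \<open>s\<close>, \<open>u\<close>, \<open>w\<close>.\<close>

lemma frame_gram:
  fixes s u w :: "'a::{field,finite}"
  assumes char2: "(1 :: 'a) + 1 = 0" and card: "CARD('a) > 2"
  shows "(\<Sum>p\<in>UNIV. frame_weight s u w p * hyperoval_eval a' b' c' (hyperoval_inv p) *
      hyperoval_eval a b c p) = (1 + s) * a * a' + (1 + u) * b * b' + (1 + w) * c * c'"
proof -
  obtain g :: 'a where g: "g \<noteq> 0" "g \<noteq> 1" using field_elem_not_0_1[OF card] .
  have g2: "g\<^sup>2 \<noteq> 1" using char_two_square_inj[OF char2, of g 1] g by auto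
  have T1: "(\<Sum>x\<in>-{0}. x :: 'a) = 0"
    by (rule sum_nonzero_eq_0[of g g]) (use g in auto)
  have T2: "(\<Sum>x\<in>-{0}. x\<^sup>2 :: 'a) = 0"
    by (rule sum_nonzero_eq_0[of g "g\<^sup>2"]) (use g g2 in \<open>auto simp: power_mult_distrib\<close>)
  have T3: "(\<Sum>x\<in>-{0}. inverse x :: 'a) = 0"
    by (rule sum_nonzero_eq_0[of g "inverse g"]) (use g in auto)
  have T4: "(\<Sum>x\<in>-{0}. (inverse x)\<^sup>2 :: 'a) = 0"
    by (rule sum_nonzero_eq_0[of g "inverse (g\<^sup>2)"])
      (use g g2 in \<open>auto simp: power_mult_distrib power_inverse\<close>)
  \<comment> \<open>There are q - 1 nonzero elements, and q - 1 = -1 = 1 in the field.\<close>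
  have T0: "of_nat (card (-{0::'a})) = (1 :: 'a)"
  proof -
    have "CARD('a) = Suc (card (-{0::'a}))" using card by (simp add: card_Compl_finite)
    then have "1 + of_nat (card (-{0::'a})) = (0 :: 'a)"
      using of_nat_card_field[where 'a = 'a] by simp
    then show ?thesis using char2 by (metis add_left_cancel)
  qed
  have "(\<Sum>x\<in>-{0}. (a' + b' * inverse x + c' * (inverse x)\<^sup>2) * (a + b * x + c * x\<^sup>2))
      = (\<Sum>x\<in>-{0}. (a * a' + b * b' + c * c') + (a' * b + b' * c) * x + a' * c * x\<^sup>2
          + (a * b' + b * c') * inverse x + a * c' * (inverse x)\<^sup>2)"
    by (rule sum.cong) (auto simp: field_simps power2_eq_square)
  also have "\<dots> = a * a' + b * b' + c * c'"
    by (simp add: sum.distrib T0 T1 T2 T3 T4 flip: sum_distrib_left)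
  finally have nz: "(\<Sum>x\<in>-{0}. (a' + b' * inverse x + c' * (inverse x)\<^sup>2) * (a + b * x + c * x\<^sup>2))
      = a * a' + b * b' + c * c'" .
  \<comment> \<open>At \<open>x = 0\<close> both factors reduce to \<open>a'\<close> and
    \<open>a\<close>, since \<open>inverse 0 = 0\<close>.\<close>
  have "(\<Sum>x\<in>UNIV. (if x = 0 then s else 1) * (a' + b' * inverse x + c' * (inverse x)\<^sup>2) *
        (a + b * x + c * x\<^sup>2))
      = s * a' * a + (\<Sum>x\<in>-{0}. (if x = 0 then s else 1) *
        (a' + b' * inverse x + c' * (inverse x)\<^sup>2) * (a + b * x + c * x\<^sup>2))"
    by (subst sum.remove[of UNIV 0]) (auto simp: Compl_eq_Diff_UNIV)
  also have "\<dots> = s * a' * a + (a * a' + b * b' + c * c')"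
    by (subst nz[symmetric]) (auto intro: sum.cong)
  finally show ?thesis
    by (simp add: sum_option_option frame_weight_def hyperoval_inv_def algebra_simps)
qed

text \<open>By the diagonal Gram matrix, a codeword lies in the weighted dual iff its coefficients
  vanish wherever the frame weight differs from 1. The frame coordinates of weight 1 are thus an
  information set of the intersection.\<close>

lemma dim_intersection:
  fixes h :: "'n::finite \<Rightarrow> 'a::{field,finite} option option"
  assumes h: "bij h" and char2: "(1 :: 'a) + 1 = 0" and card: "CARD('a) > 2"
  shows "vec.dim (hyperoval_code h \<inter>
      weighted_dual (frame_weight s u w \<circ> h) (hyperoval_code (hyperoval_inv \<circ> h)))
    = of_bool (s = 1) + of_bool (u = 1) + of_bool (w = 1)"
    (is "vec.dim (_ \<inter> ?D) = _")
proof -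
  obtain i0 i1 i2 where i: "h i0 = Some (Some 0)" "h i1 = Some None" "h i2 = None"
    "i0 \<noteq> i1" "i0 \<noteq> i2" "i1 \<noteq> i2"
    using hyperoval_frame[OF h] .
  define I where "I = (if s = 1 then {i0} else {}) \<union> (if u = 1 then {i1} else {})
    \<union> (if w = 1 then {i2} else {})"
  have one_plus: "1 + t = 0 \<longleftrightarrow> t = 1" for t :: 'a
    using char2 by (metis add_left_cancel)
  have mem: "(\<chi> i. hyperoval_eval a b c (h i)) \<in> ?D \<longleftrightarrow>
    (s = 1 \<or> a = 0) \<and> (u = 1 \<or> b = 0) \<and> (w = 1 \<or> c = 0)" for a b c
  proof -
    have "(\<Sum>i\<in>UNIV. (frame_weight s u w \<circ> h) i * hyperoval_eval a' b' c' ((hyperoval_inv \<circ> h) i) *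
        hyperoval_eval a b c (h i)) = (1 + s) * a * a' + (1 + u) * b * b' + (1 + w) * c * c'"
      for a' b' c'
      unfolding frame_gram[OF char2 card, symmetric] o_def
      by (rule sum.reindex_bij_betw[OF h])
    then show ?thesis
      by (simp add: mem_weighted_dual_hyperoval' one_plus)
  qed
  have "vec.dim (hyperoval_code h \<inter> ?D) = card I"
  proof (rule dim_information_set)
    show "vec.subspace (hyperoval_code h \<inter> ?D)"
      by (intro vec.subspace_inter subspace_hyperoval_code subspace_weighted_dual)
    fix x assume x: "x \<in> hyperoval_code h \<inter> ?D" and z: "\<And>i. i \<in> I \<Longrightarrow> x $ i = 0"
    from x obtain a b c where x': "x = (\<chi> i. hyperoval_eval a b c (h i))"
      by (auto simp: hyperoval_code_def)
    have "a = 0" "b = 0" "c = 0"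
      using x mem[of a b c] z[of i0] z[of i1] z[of i2] i by (auto simp: x' I_def)
    then show "x = 0" by (auto simp: x' vec_eq_iff hyperoval_eval_def split: option.split)
  next
    fix y :: "'a ^ 'n"
    let ?x = "\<chi> i. hyperoval_eval (if s = 1 then y $ i0 else 0) (if u = 1 then y $ i1 else 0)
      (if w = 1 then y $ i2 else 0) (h i)"
    have "?x \<in> hyperoval_code h \<inter> ?D" using mem by (auto simp: hyperoval_code_def)
    moreover have "\<forall>i\<in>I. ?x $ i = y $ i" using i by (auto simp: I_def)
    ultimately show "\<exists>x \<in> hyperoval_code h \<inter> ?D. \<forall>i\<in>I. x $ i = y $ i" by blast
  qed
  also have "card I = of_bool (s = 1) + of_bool (u = 1) + of_bool (w = 1)"
    using i by (auto simp: I_def)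
  finally show ?thesis .
qed

section \<open>Choice of the weights for a prescribed intersection dimension\<close>

theorem theorem7:
  fixes m l :: nat
  assumes "CARD('a::{field,finite}) = 2 ^ m"
    and "2 ^ m > (4::nat)"
    and "CARD('n::finite) = 2 ^ m + 2"
    and "l \<le> 3"
  shows "\<exists>C1 C2 :: ('a ^ 'n) set.
           is_MDS C1 \<and> is_MDS C2 \<and>
           is_code_nkd C1 (2 ^ m + 2) 3 (2 ^ m) \<and>
           is_code_nkd C2 (2 ^ m + 2) (2 ^ m - 1) 4 \<and>
           l_intersection_pair C1 C2 l"
proof -
  note q = assms(1) and q4 = assms(2) and n = assms(3) and l = assms(4)
  have char2: "(1 :: 'a) + 1 = 0" by (rule char_two_of_card[OF q])
  have "card (UNIV :: 'n set) = card (UNIV :: 'a option option set)"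
    using q n by (simp add: card_UNIV_option)
  then obtain h :: "'n \<Rightarrow> 'a option option" where h: "bij h"
    using finite_same_card_bij[OF finite finite] by blast
  then have h': "bij (hyperoval_inv \<circ> h)" by (intro bij_comp bij_hyperoval_inv)
  have card: "CARD('a) > 2" using q q4 by simp
  obtain t :: 'a where t: "t \<noteq> 0" "t \<noteq> 1" using field_elem_not_0_1[OF card] .
  \<comment> \<open>Exactly the first \<open>l\<close> of the three weights equal 1; the others are
    \<open>t\<close>, which is not 1 but nonzero, as the dual code requires.\<close>
  define s u w where "s = (if 1 \<le> l then 1 else t)" and "u = (if 2 \<le> l then 1 else t)"
    and "w = (if 3 \<le> l then 1 else t)"
  define W where "W = frame_weight s u w \<circ> h"
  have W: "W i \<noteq> 0" for i
    using t by (auto simp: W_def frame_weight_def s_def u_def w_def split: option.split)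
  define C1 where "C1 = hyperoval_code h"
  define C2 where "C2 = weighted_dual W (hyperoval_code (hyperoval_inv \<circ> h))"
  have C1: "linear_code C1" "vec.dim C1 = 3" "min_dist C1 = 2 ^ m"
    using subspace_hyperoval_code dim_hyperoval_code[OF h] min_dist_hyperoval_code[OF h char2] q
    by (auto simp: C1_def linear_code_def)
  have C2: "linear_code C2" "vec.dim C2 = 2 ^ m - 1" "min_dist C2 = 4"
    using subspace_weighted_dual dim_weighted_dual_hyperoval[OF h' W]
      min_dist_weighted_dual_hyperoval[OF h' char2 W] n
    by (auto simp: C2_def linear_code_def)
  have "vec.dim (C1 \<inter> C2) = of_bool (s = 1) + of_bool (u = 1) + of_bool (w = 1)"
    unfolding C1_def C2_def W_def by (rule dim_intersection[OF h char2 card])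
  also have "\<dots> = l" using l t by (auto simp: s_def u_def w_def)
  finally have "vec.dim (C1 \<inter> C2) = l" .
  \<comment> \<open>With q = 2^m, the MDS conditions read q = (q + 2) - 3 + 1 and 4 = (q + 2) - (q -
    1) + 1.\<close>
  then have "is_MDS C1 \<and> is_MDS C2 \<and> is_code_nkd C1 (2 ^ m + 2) 3 (2 ^ m) \<and>
      is_code_nkd C2 (2 ^ m + 2) (2 ^ m - 1) 4 \<and> l_intersection_pair C1 C2 l"
    using C1 C2 n q4 by (simp add: is_MDS_def is_code_nkd_def l_intersection_pair_def)
  then show ?thesis by blast
qed

end
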